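(* Let $k\ge 2$ and let $n_0,n_1,\dots,n_k$ be positive integers. Then $$\mathrm{F}([n_0;n_1,\dots,n_k]) = F^{(n_{k-1})}\,F_{n_k}+F^{(n_{k-1}-1)}\,F_{n_k+1},$$ where the integers $F^{(n_j)}$ and $F^{(n_j-1)}$, $1\le j\le k-1$, are defined recursively by $$F^{(n_1)}=F_{n_0}F_{n_1}+F_{n_0-1}F_{n_1+1},\qquad F^{(n_1-1)}=F_{n_0}F_{n_1-1}+F_{n_0-1}F_{n_1},$$ and, for $2\le j\le k-1$, $$F^{(n_j)}=F^{(n_{j-1})}F_{n_j}+F^{(n_{j-1}-1)}F_{n_j+1},\qquad F^{(n_j-1)}=F^{(n_{j-1})}F_{n_j-1}+F^{(n_{j-1}-1)}F_{n_j}.$$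
   Context: The symbols $F^{(n_j)}$ and $F^{(n_j-1)}$ are just names for two integers attached to position $j$ (depending on $n_0,\dots,n_j$). $[n_0;n_1,\dots,n_k]$ denotes the finite continued fraction $n_0+1/(n_1+1/(\cdots+1/n_k))$. The conumerator function is the unique map $\mathrm{con}:\mathbb{Q}_{>0}\to\mathbb{Z}_{>0}$ with $\mathrm{con}(1)=1$ and, for all $X\in\mathbb{Q}_{>0}$, $\mathrm{con}(1+X)=\mathrm{con}(X)+\mathrm{con}(1/X)$ and $\mathrm{con}\left(\tfrac{1}{1+X}\right)=\mathrm{con}(X)$. The codenominator function is $\mathrm{F}(X):=\mathrm{con}(1/X)$ for $X\in\mathbb{Q}_{>0}$; equivalently $\mathrm{F}(1)=1$, $\mathrm{F}(1+X)=\mathrm{F}(1/X)$, $\mathrm{F}\left(\tfrac{1}{1+X}\right)=\mathrm{F}(X)+\mathrm{F}(1/X)$. The Fibonacci numbers are $F_0=0$, $F_1=1$, $F_n=F_{n-1}+F_{n-2}$. *)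

theory Defs
  imports Complex_Main "HOL-Library.FuncSet" "HOL-Number_Theory.Fib"
begin

fun finite_cfrac :: "nat list \<Rightarrow> rat" where
  "finite_cfrac [a] = of_nat a"
| "finite_cfrac (a # b # as) = of_nat a + 1 / finite_cfrac (b # as)"

text \<open>Maps from positive rationals to positive integers are represented as extensional functions
  (fixed to the value \<open>undefined\<close> at nonpositive arguments), so that uniqueness is meaningful.\<close>

definition is_conumerator :: "(rat \<Rightarrow> int) \<Rightarrow> bool" where
  "is_conumerator f \<longleftrightarrow>
     f \<in> {0<..} \<rightarrow>\<^sub>E {0<..} \<and>
     f 1 = 1 \<and>
     (\<forall>X>0. f (1 + X) = f X + f (1 / X)) \<and>
     (\<forall>X>0. f (1 / (1 + X)) = f X)"

definition conumerator :: "rat \<Rightarrow> int" where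
  "conumerator = (THE f. is_conumerator f)"

definition codenominator :: "rat \<Rightarrow> int" where
  "codenominator X = conumerator (1 / X)"

text \<open>The rest of this theory shows that the description in \<open>conumerator_def\<close> is proper.
  The auxiliary function computes the conumerator of \<open>p / q\<close> for coprime positive \<open>p\<close> and \<open>q\<close>.\<close>

function conum_aux :: "int \<Rightarrow> int \<Rightarrow> int" where
  "conum_aux p q =
     (if p \<le> 0 \<or> q \<le> 0 \<or> p = q then 1
      else if p > q then conum_aux (p - q) q + conum_aux q (p - q)
      else conum_aux (q - p) p)"
  by pat_completeness auto
termination by (relation "measure (\<lambda>(p, q). nat (p + q))") auto

declare conum_aux.simps [simp del]

lemma conum_aux_pos: "conum_aux p q > 0"
proof (induction p q rule: conum_aux.induct)
  case (1 p q)
  then show ?case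
    by (subst conum_aux.simps) (auto intro: add_pos_pos)
qed

lemma conum_aux_add:
  assumes "p > 0" "q > 0"
  shows "conum_aux (p + q) q = conum_aux p q + conum_aux q p"
    and "conum_aux q (p + q) = conum_aux p q"
  using assms by (subst conum_aux.simps, simp)+

lemma pos_rat_cases:
  fixes X :: rat
  assumes "X > 0"
  obtains p q where "X = Fract p q" "p > 0" "q > 0" "coprime p q"
  using assms by (cases X rule: Rat_cases) (auto simp: zero_less_Fract_iff)

lemma pos_rat_Fract:
  assumes "p > 0" "q > 0"
  shows "1 + Fract p q = Fract (p + q) q" "1 / Fract p q = Fract q p"
    "1 / (1 + Fract p q) = Fract q (p + q)"
  using assms by (simp_all add: One_rat_def add.commute)

lemma ex_is_conumerator: "\<exists>f. is_conumerator f"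
proof -
  define f where
    "f X = (if X > 0 then case quotient_of X of (p, q) \<Rightarrow> conum_aux p q else undefined)" for X
  have f: "f (Fract p q) = conum_aux p q" if "p > 0" "q > 0" "coprime p q" for p q
    using that by (simp add: f_def zero_less_Fract_iff quotient_of_Fract normalize_stable)
  have "f 1 = 1"
    using f[of 1 1] by (simp add: One_rat_def conum_aux.simps)
  moreover have "f \<in> {0<..} \<rightarrow>\<^sub>E {0<..}"
    by (auto simp: f_def conum_aux_pos split: prod.splits if_splits)
  moreover have "f (1 + X) = f X + f (1 / X) \<and> f (1 / (1 + X)) = f X" if "X > 0" for X
  proof -
    obtain p q where X: "X = Fract p q" "p > 0" "q > 0" "coprime p q"
      using \<open>X > 0\<close> by (rule pos_rat_cases)
    have "coprime (p + q) q"
      using X(4) by (simp add: coprime_iff_gcd_eq_1)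
    moreover from this X(4) have "coprime q (p + q)" "coprime q p"
      by (simp_all only: coprime_commute)
    ultimately show ?thesis
      unfolding X(1) using X by (simp add: pos_rat_Fract f conum_aux_add)
  qed
  ultimately show ?thesis
    unfolding is_conumerator_def by blast
qed

lemma is_conumerator_unique:
  assumes f: "is_conumerator f" and g: "is_conumerator g"
  shows "f = g"
proof -
  have eq: "f (Fract p q) = g (Fract p q)" if "p > 0" "q > 0" for p q
    using that
  proof (induction p q rule: conum_aux.induct)
    case (1 p q)
    consider "p = q" | "p > q" | "p < q" by linarith
    then show ?case
    proof cases
      case 1
      then have "Fract p q = 1"
        using \<open>q > 0\<close> by (simp add: One_rat_def eq_rat)
      then show ?thesis
        using f g by (simp add: is_conumerator_def)
    next
      case 2
      define X where "X = Fract (p - q) q"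
      have X: "X > 0" "1 + X = Fract p q" "1 / X = Fract q (p - q)"
        using 2 \<open>q > 0\<close> pos_rat_Fract[of "p - q" q] by (simp_all add: X_def zero_less_Fract_iff)
      have "f X = g X" "f (1 / X) = g (1 / X)"
        unfolding X(3) unfolding X_def using 1 2 by auto
      then have "f (1 + X) = g (1 + X)"
        using f g X(1) by (simp add: is_conumerator_def)
      then show ?thesis by (simp only: X(2))
    next
      case 3
      define X where "X = Fract (q - p) p"
      have X: "X > 0" "1 / (1 + X) = Fract p q"
        using 3 \<open>p > 0\<close> pos_rat_Fract[of "q - p" p] by (simp_all add: X_def zero_less_Fract_iff)
      have "f X = g X"
        unfolding X_def using 1 3 by auto
      then have "f (1 / (1 + X)) = g (1 / (1 + X))"
        using f g X(1) by (simp add: is_conumerator_def)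
      then show ?thesis by (simp only: X(2))
    qed
  qed
  have "f \<in> extensional {0<..}" "g \<in> extensional {0<..}"
    using f g by (auto simp: is_conumerator_def PiE_def)
  then show ?thesis
    by (rule extensionalityI) (auto elim!: pos_rat_cases simp: eq)
qed

lemma is_conumerator_conumerator: "is_conumerator conumerator"
  unfolding conumerator_def
  using ex_is_conumerator is_conumerator_unique by (metis theI)

end

(* Write c for the conumerator and F X = c (1 / X). The pair (F, c) transforms linearly under
   Y |-> m + 1 / Y, with Fibonacci coefficients. Peeling off the partial quotients one after the
   other gives F [n_0; ..., n_j, Y] = A_j * F Y + B_j * c Y by induction on j, where (A_j, B_j)
   is the row vector obtained by multiplying these coefficient matrices. It remains to put
   Y = n_k, where F Y = fib n_k and c Y = fib (n_k + 1). *)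
theory Submission
  imports Defs
begin

lemma conumerator_one: "conumerator 1 = 1"
  and conumerator_one_add: "X > 0 \<Longrightarrow> conumerator (1 + X) = conumerator X + conumerator (1 / X)"
  and conumerator_inverse_one_add: "X > 0 \<Longrightarrow> conumerator (1 / (1 + X)) = conumerator X"
  using is_conumerator_conumerator by (simp_all add: is_conumerator_def)

text \<open>Induction on \<open>m\<close>, moving one unit of \<open>m\<close> into
  \<open>X\<close>. Replacing \<open>X\<close> by \<open>1 + X\<close> turns the pair of values at
  (\<open>1 / X\<close>, \<open>X\<close>) into (second, first + second), which is one Fibonacci
  step; hence \<open>X\<close> is kept arbitrary.\<close>

lemma conumerator_of_nat_add:
  assumes "X > 0"
  shows "conumerator (of_nat m + X) =
           int (fib m) * conumerator (1 / X) + int (fib (m + 1)) * conumerator X"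
  using assms
proof (induction m arbitrary: X)
  case 0
  then show ?case by simp
next
  case (Suc m)
  have "conumerator (of_nat (Suc m) + X) = conumerator (of_nat m + (1 + X))"
    by (simp add: add_ac)
  also have "\<dots> = int (fib m) * conumerator X
      + int (fib (m + 1)) * (conumerator X + conumerator (1 / X))"
    using Suc by (simp only: conumerator_one_add conumerator_inverse_one_add add_pos_pos zero_less_one)
  finally show ?case by (simp add: algebra_simps)
qed

text \<open>One unit is absorbed by the law for \<open>1 / (1 + X)\<close>: the codenominator at
  \<open>m + X\<close> is the conumerator at \<open>(m - 1) + X\<close>, which explains the index
  shift.\<close>

lemma codenominator_of_nat_add:
  assumes "X > 0" "m > 0"
  shows "codenominator (of_nat m + X) =
           int (fib m) * conumerator X + int (fib (m - 1)) * conumerator (1 / X)"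
proof -
  have "of_nat m + X = 1 + (of_nat (m - 1) + X)"
    using \<open>m > 0\<close> by (simp add: of_nat_diff)
  moreover have "of_nat (m - 1) + X > 0"
    using \<open>X > 0\<close> by (rule add_nonneg_pos[OF of_nat_0_le_iff])
  ultimately have "codenominator (of_nat m + X) = conumerator (of_nat (m - 1) + X)"
    by (simp only: codenominator_def conumerator_inverse_one_add)
  also have "\<dots> = int (fib (m - 1)) * conumerator (1 / X) + int (fib (m - 1 + 1)) * conumerator X"
    using \<open>X > 0\<close> by (rule conumerator_of_nat_add)
  finally show ?thesis using \<open>m > 0\<close> by simp
qed

lemma conumerator_of_nat:
  assumes "m > 0"
  shows "conumerator (of_nat m) = int (fib (m + 1))"
  using assms conumerator_of_nat_add[of 1 "m - 1"]
  by (cases m) (simp_all add: conumerator_one add_ac)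

lemma codenominator_of_nat:
  assumes "m > 0"
  shows "codenominator (of_nat m) = int (fib m)"
\<comment> \<open>Writing \<open>m\<close> as \<open>(m - 1) + 1\<close> allows the addition formula
  only if \<open>m - 1\<close> is positive.\<close>
proof (cases "m = 1")
  case True
  then show ?thesis by (simp add: codenominator_def conumerator_one)
next
  case False
  with assms obtain l where "m = Suc (Suc l)"
    by (metis One_nat_def gr0_implies_Suc not0_implies_Suc)
  then show ?thesis
    using codenominator_of_nat_add[of 1 "m - 1"] by (simp add: conumerator_one add_ac)
qed

lemma finite_cfrac_pos:
  assumes "xs \<noteq> []" "\<forall>x\<in>set xs. x > 0"
  shows "finite_cfrac xs > 0"
  using assms by (induction xs rule: finite_cfrac.induct) (auto intro: add_pos_pos)

theorem lemma4p2:
  fixes n :: "nat \<Rightarrow> nat" and k :: nat and A B :: "nat \<Rightarrow> int"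
  assumes "k \<ge> 2"
    and "\<And>i. i \<le> k \<Longrightarrow> n i > 0"
    (* A j is the integer written F^(n_j), and B j the one written F^(n_j - 1) *)
    and "A 1 = int (fib (n 0)) * int (fib (n 1)) + int (fib (n 0 - 1)) * int (fib (n 1 + 1))"
    and "B 1 = int (fib (n 0)) * int (fib (n 1 - 1)) + int (fib (n 0 - 1)) * int (fib (n 1))"
    and "\<And>j. 2 \<le> j \<Longrightarrow> j \<le> k - 1 \<Longrightarrow>
           A j = A (j - 1) * int (fib (n j)) + B (j - 1) * int (fib (n j + 1))"
    and "\<And>j. 2 \<le> j \<Longrightarrow> j \<le> k - 1 \<Longrightarrow>
           B j = A (j - 1) * int (fib (n j - 1)) + B (j - 1) * int (fib (n j))"
  shows "codenominator (finite_cfrac (map n [0..<k + 1])) =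
           A (k - 1) * int (fib (n k)) + B (k - 1) * int (fib (n k + 1))"
proof -
  \<comment> \<open>The complete quotients: \<open>Y j\<close> is the tail starting at
    \<open>n j\<close>.\<close>
  define Y where "Y j = finite_cfrac (map n [j..<k + 1])" for j
  have Y_pos: "Y j > 0" if "j \<le> k" for j
    unfolding Y_def using that assms(2) by (intro finite_cfrac_pos) auto
  have Y_step: "Y j = of_nat (n j) + 1 / Y (Suc j)" if "j < k" for j
    using that by (simp add: Y_def upt_conv_Cons del: upt_Suc)
  \<comment> \<open>The addition formulas are used at \<open>1 / Y (Suc j)\<close>, so conumerator
    and codenominator trade places on the right.\<close>
  have codenominator_Y: "codenominator (Y j) = int (fib (n j)) * codenominator (Y (Suc j))
      + int (fib (n j - 1)) * conumerator (Y (Suc j))" if "j < k" for j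
    using that Y_pos[of "Suc j"] assms(2)[of j] codenominator_of_nat_add[of "1 / Y (Suc j)" "n j"]
    by (simp add: Y_step codenominator_def)
  have conumerator_Y: "conumerator (Y j) = int (fib (n j)) * conumerator (Y (Suc j))
      + int (fib (n j + 1)) * codenominator (Y (Suc j))" if "j < k" for j
    using that Y_pos[of "Suc j"] conumerator_of_nat_add[of "1 / Y (Suc j)" "n j"]
    by (simp add: Y_step codenominator_def)
  have "codenominator (Y 0) = A j * codenominator (Y (Suc j)) + B j * conumerator (Y (Suc j))"
    if "1 \<le> j" "j \<le> k - 1" for j
    using that
  proof (induction j rule: dec_induct)
    case base
    \<comment> \<open>\<open>A 1\<close> and \<open>B 1\<close> already combine \<open>n 0\<close>
      and \<open>n 1\<close>, so the base case peels off two partial quotients.\<close>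
    have "codenominator (Y 0) = int (fib (n 0)) * codenominator (Y 1)
        + int (fib (n 0 - 1)) * conumerator (Y 1)"
      using codenominator_Y[of 0] \<open>k \<ge> 2\<close> by simp
    then show ?case
      using codenominator_Y[of 1] conumerator_Y[of 1] \<open>k \<ge> 2\<close> assms(3,4)
      by (simp add: algebra_simps)
  next
    case (step j)
    then show ?case
      using codenominator_Y[of "Suc j"] conumerator_Y[of "Suc j"]
        assms(5)[of "Suc j"] assms(6)[of "Suc j"]
      by (simp add: algebra_simps)
  qed
  from this[of "k - 1"] have "codenominator (Y 0) =
      A (k - 1) * codenominator (Y k) + B (k - 1) * conumerator (Y k)"
    using \<open>k \<ge> 2\<close> by simp
  moreover have "Y k = of_nat (n k)"
    by (simp add: Y_def)
  ultimately show ?thesis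
    using assms(2)[of k] by (simp add: Y_def codenominator_of_nat conumerator_of_nat del: upt_Suc)
qed

end
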